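(* Let $G$ be a compact Lie group acting linearly on a real Banach space $X$ and let $f:X\to[-\infty,+\infty]$ be a $G$-invariant functional (that is, $f(gu)=f(u)$ for all $u\in X$, $g\in G$). Assume that for every $u\in \mathrm{Fix}(G)$ there exists a $G$-invariant dense vector subspace $V_u$ of $X$ such that: 1. for all $v\in V_u$ the directional derivative $f'(u)v$ exists; 2. for all $v\in V_u\cap \mathrm{Fix}(G)$: $(f|_{\mathrm{Fix}(G)})^\circ(u;v)\le f'(u)v$; 3. for all $v\in V_u$: $f^\circ(u;v)\le f'(u)v$; 4. $V_u=\bigcup_{j\in J}C_j$, where each $C_j$ is convex, closed, $G$-invariant, and such that the restriction $f'(u)|_{C_j}$ is continuous. Let $u\in \mathrm{Fix}(G)$ with $f(u)\in\mathbb{R}$ be a critical point of $f|_{\mathrm{Fix}(G)}$, i.e. $0\in\partial(f|_{\mathrm{Fix}(G)})(u)$. Then $$f'(u)v=0\qquad\text{for all } v\in V_u.$$ Furthermore, $\partial f(u)=\{0\}$ provided that $\partial f(u)$ is nonempty.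
   Context: $\mathrm{Fix}(G)=\{u\in X: gu=u\ \forall g\in G\}$ is a closed subspace of $X$, itself regarded as a Banach space. A subset $C\subseteq X$ is $G$-invariant if $gC\subseteq C$ for all $g\in G$. The directional derivative of $f$ at $u$ along $v$ is $f'(u)v=\lim_{t\to0}\frac{f(u+tv)-f(u)}{t}$. Conditions 1–3 are understood at points $u$ with $f(u)\in\mathbb{R}$, where the notions involved are defined. Let $Y$ be a real normed space and $f:Y\to[-\infty,+\infty]$. Set $\mathrm{epi}(f)=\{(u,\xi)\in Y\times\mathbb{R}: f(u)\le\xi\}$, with the metric $d((u,\xi),(w,\mu))=(\|u-w\|^2+(\xi-\mu)^2)^{1/2}$; $B_\delta(\cdot)$ denotes an open ball of radius $\delta$. Generalized directional derivative: let $u\in Y$ with $f(u)\in\mathbb{R}$. For $v\in Y$ and $\varepsilon>0$, $f^\circ_\varepsilon(u;v)$ is the infimum of the $r\in\mathbb{R}$ such that there exist $\delta>0$ and a continuous map $\mathcal V:(B_\delta(u,f(u))\cap\mathrm{epi}(f))\times\,]0,\delta]\to B_\varepsilon(v)$ with $f(\xi+t\mathcal V((\xi,\mu),t))\le\mu+rt$ for all $(\xi,\mu)\in B_\delta(u,f(u))\cap\mathrm{epi}(f)$ and $t\in\,]0,\delta]$; and $f^\circ(u;v)=\sup_{\varepsilon>0}f^\circ_\varepsilon(u;v)$. Subdifferential: $\partial f(u)=\{\alpha\in Y^*:\langle\alpha,v\rangle\le f^\circ(u;v)\ \forall v\in Y\}$. For the restriction $f|_{\mathrm{Fix}(G)}$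 these notions are taken in $Y=\mathrm{Fix}(G)$.
   Formalization: When ∂f(u) is empty at the critical point u, the formal theorem additionally assumes that f'(u) is additive on V_u; without this the statement as written is false, since f'(u)v is only defined as a directional limit and need not be linear in v. *)

theory Defs
  imports "HOL-Analysis.Analysis" "HOL-Algebra.Group_Action"
begin

section \<open>Compact Lie groups\<close>

text \<open>
  Charts take values in \<^term>\<open>Euclidean_space n\<close>, whose points are the functions
  \<^typ>\<open>nat \<Rightarrow> real\<close> vanishing from index \<open>n\<close> on. In this way \<open>n\<close> is an ordinary natural number
  and \<open>n = 0\<close> is allowed, so that finite groups are Lie groups.
\<close>

definition partial_deriv :: "nat \<Rightarrow> ((nat \<Rightarrow> real) \<Rightarrow> real) \<Rightarrow> (nat \<Rightarrow> real) \<Rightarrow> real" where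
  "partial_deriv i f x = deriv (\<lambda>s. f (x(i := s))) (x i)"

fun Ck_on :: "nat \<Rightarrow> nat \<Rightarrow> (nat \<Rightarrow> real) set \<Rightarrow> ((nat \<Rightarrow> real) \<Rightarrow> real) \<Rightarrow> bool" where
  "Ck_on n 0 S f \<longleftrightarrow> continuous_map (subtopology (Euclidean_space n) S) euclideanreal f"
| "Ck_on n (Suc k) S f \<longleftrightarrow>
     continuous_map (subtopology (Euclidean_space n) S) euclideanreal f \<and>
     (\<forall>i<n. (\<forall>x\<in>S. (\<lambda>s. f (x(i := s))) differentiable (at (x i))) \<and>
            Ck_on n k S (partial_deriv i f))"

definition smooth_on ::
  "nat \<Rightarrow> nat \<Rightarrow> (nat \<Rightarrow> real) set \<Rightarrow> ((nat \<Rightarrow> real) \<Rightarrow> (nat \<Rightarrow> real)) \<Rightarrow> bool" where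
  "smooth_on n m S F \<longleftrightarrow>
     openin (Euclidean_space n) S \<and> F ` S \<subseteq> topspace (Euclidean_space m) \<and>
     (\<forall>k. \<forall>j<m. Ck_on n k S (\<lambda>x. F x j))"

definition chart :: "'g topology \<Rightarrow> nat \<Rightarrow> 'g set \<times> ('g \<Rightarrow> nat \<Rightarrow> real) \<Rightarrow> bool" where
  "chart T n = (\<lambda>(U, \<phi>). openin T U \<and> openin (Euclidean_space n) (\<phi> ` U) \<and>
     homeomorphic_map (subtopology T U) (subtopology (Euclidean_space n) (\<phi> ` U)) \<phi>)"

definition smooth_atlas ::
  "'g topology \<Rightarrow> nat \<Rightarrow> ('g set \<times> ('g \<Rightarrow> nat \<Rightarrow> real)) set \<Rightarrow> bool" where
  "smooth_atlas T n A \<longleftrightarrow>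
     (\<forall>c\<in>A. chart T n c) \<and> (\<Union>(U, \<phi>)\<in>A. U) = topspace T \<and>
     (\<forall>(U, \<phi>)\<in>A. \<forall>(V, \<psi>)\<in>A. smooth_on n n (\<phi> ` (U \<inter> V)) (\<psi> \<circ> inv_into U \<phi>))"

text \<open>
  Smoothness of the multiplication is expressed in product charts, a point \<open>z\<close> of the
  \<open>2n\<close>-dimensional space being the pair \<open>(fst_half n z, snd_half n z)\<close>.
\<close>

definition fst_half :: "nat \<Rightarrow> (nat \<Rightarrow> real) \<Rightarrow> (nat \<Rightarrow> real)" where
  "fst_half n z = (\<lambda>i. if i < n then z i else 0)"

definition snd_half :: "nat \<Rightarrow> (nat \<Rightarrow> real) \<Rightarrow> (nat \<Rightarrow> real)" where
  "snd_half n z = (\<lambda>i. if i < n then z (n + i) else 0)"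

definition lie_group ::
  "('g, 'm) monoid_scheme \<Rightarrow> 'g topology \<Rightarrow> nat \<Rightarrow> ('g set \<times> ('g \<Rightarrow> nat \<Rightarrow> real)) set \<Rightarrow> bool" where
  "lie_group G T n A \<longleftrightarrow>
     group G \<and> topspace T = carrier G \<and> Hausdorff_space T \<and> second_countable T \<and>
     smooth_atlas T n A \<and>
     continuous_map (prod_topology T T) T (\<lambda>(x, y). x \<otimes>\<^bsub>G\<^esub> y) \<and>
     continuous_map T T (\<lambda>x. inv\<^bsub>G\<^esub> x) \<and>
     (\<forall>(U, \<phi>)\<in>A. \<forall>(V, \<psi>)\<in>A. \<forall>(W, \<theta>)\<in>A.
        smooth_on (2 * n) n
          {z \<in> topspace (Euclidean_space (2 * n)).
             fst_half n z \<in> \<phi> ` U \<and> snd_half n z \<in> \<psi> ` V \<and>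
             inv_into U \<phi> (fst_half n z) \<otimes>\<^bsub>G\<^esub> inv_into V \<psi> (snd_half n z) \<in> W}
          (\<lambda>z. \<theta> (inv_into U \<phi> (fst_half n z) \<otimes>\<^bsub>G\<^esub> inv_into V \<psi> (snd_half n z)))) \<and>
     (\<forall>(U, \<phi>)\<in>A. \<forall>(V, \<psi>)\<in>A.
        smooth_on n n {z \<in> \<phi> ` U. inv\<^bsub>G\<^esub> (inv_into U \<phi> z) \<in> V}
          (\<lambda>z. \<psi> (inv\<^bsub>G\<^esub> (inv_into U \<phi> z))))"

definition compact_lie_group ::
  "('g, 'm) monoid_scheme \<Rightarrow> 'g topology \<Rightarrow> nat \<Rightarrow> ('g set \<times> ('g \<Rightarrow> nat \<Rightarrow> real)) set \<Rightarrow> bool" where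
  "compact_lie_group G T n A \<longleftrightarrow> lie_group G T n A \<and> compact_space T"


section \<open>Linear actions\<close>

definition linear_action ::
  "('g, 'm) monoid_scheme \<Rightarrow> 'g topology \<Rightarrow> ('g \<Rightarrow> 'x \<Rightarrow> 'x::real_normed_vector) \<Rightarrow> bool" where
  "linear_action G T act \<longleftrightarrow>
     group_action G UNIV act \<and> (\<forall>g\<in>carrier G. linear (act g)) \<and>
     continuous_map (prod_topology T euclidean) euclidean (\<lambda>(g, u). act g u)"

definition Fix :: "('g, 'm) monoid_scheme \<Rightarrow> ('g \<Rightarrow> 'x \<Rightarrow> 'x) \<Rightarrow> 'x set" where
  "Fix G act = {u. \<forall>g\<in>carrier G. act g u = u}"

definition invariant_set ::
  "('g, 'm) monoid_scheme \<Rightarrow> ('g \<Rightarrow> 'x \<Rightarrow> 'x) \<Rightarrow> 'x set \<Rightarrow> bool" where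
  "invariant_set G act C \<longleftrightarrow> (\<forall>g\<in>carrier G. act g ` C \<subseteq> C)"


section \<open>Directional derivatives\<close>

text \<open>
  The directional derivative is the two-sided limit, required to be a real number. It is
  homogeneous in the direction wherever it exists, but not necessarily additive, so linearity of
  \<open>dir_deriv f u\<close> on a subspace has to be stated separately where it is meant.
\<close>

definition has_dir_deriv ::
  "('x::real_normed_vector \<Rightarrow> ereal) \<Rightarrow> 'x \<Rightarrow> 'x \<Rightarrow> real \<Rightarrow> bool" where
  "has_dir_deriv f u v d \<longleftrightarrow>
     ((\<lambda>t::real. (f (u + t *\<^sub>R v) - f u) / ereal t) \<longlongrightarrow> ereal d) (at 0)"

definition dir_deriv :: "('x::real_normed_vector \<Rightarrow> ereal) \<Rightarrow> 'x \<Rightarrow> 'x \<Rightarrow> real" where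
  "dir_deriv f u v = (THE d. has_dir_deriv f u v d)"


section \<open>Generalized directional derivative and subdifferential\<close>

text \<open>
  Everything is relative to a linear subspace \<open>Y\<close> of \<^typ>\<open>'x\<close>, regarded as a normed space: only the
  values of \<open>f\<close> on \<open>Y\<close> matter. The notions for \<open>f\<close> itself are those with \<open>Y = UNIV\<close>, the
  notions for the restriction of \<open>f\<close> to the fixed-point space those with \<open>Y = Fix G act\<close>. The
  distance of the product type \<^typ>\<open>'x \<times> real\<close> is the Euclidean combination of the distances.
\<close>

definition epi :: "'x set \<Rightarrow> ('x \<Rightarrow> ereal) \<Rightarrow> ('x \<times> real) set" where
  "epi Y f = {(w, \<mu>). w \<in> Y \<and> f w \<le> ereal \<mu>}"

definition gen_dir_deriv_eps ::
  "'x::real_normed_vector set \<Rightarrow> ('x \<Rightarrow> ereal) \<Rightarrow> real \<Rightarrow> 'x \<Rightarrow> 'x \<Rightarrow> ereal" where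
  "gen_dir_deriv_eps Y f \<epsilon> u v = Inf (ereal ` {r.
     \<exists>\<delta>>0. \<exists>\<V>.
       continuous_on ((ball (u, real_of_ereal (f u)) \<delta> \<inter> epi Y f) \<times> {0<..\<delta>}) \<V> \<and>
       (\<forall>(\<xi>, \<mu>) \<in> ball (u, real_of_ereal (f u)) \<delta> \<inter> epi Y f. \<forall>t\<in>{0<..\<delta>}.
          \<V> ((\<xi>, \<mu>), t) \<in> ball v \<epsilon> \<inter> Y \<and>
          f (\<xi> + t *\<^sub>R \<V> ((\<xi>, \<mu>), t)) \<le> ereal (\<mu> + r * t))})"

definition gen_dir_deriv ::
  "'x::real_normed_vector set \<Rightarrow> ('x \<Rightarrow> ereal) \<Rightarrow> 'x \<Rightarrow> 'x \<Rightarrow> ereal" where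
  "gen_dir_deriv Y f u v = (SUP \<epsilon>\<in>{0<..}. gen_dir_deriv_eps Y f \<epsilon> u v)"

text \<open>
  Functionals on \<open>Y\<close> are normalized to be \<^const>\<open>undefined\<close> off \<open>Y\<close>; for \<open>Y = UNIV\<close> this is no
  restriction.
\<close>

definition dual_space :: "'x::real_normed_vector set \<Rightarrow> ('x \<Rightarrow> real) set" where
  "dual_space Y = {\<alpha> \<in> extensional Y.
     (\<forall>v\<in>Y. \<forall>w\<in>Y. \<alpha> (v + w) = \<alpha> v + \<alpha> w) \<and>
     (\<forall>c. \<forall>v\<in>Y. \<alpha> (c *\<^sub>R v) = c * \<alpha> v) \<and>
     continuous_on Y \<alpha>}"

definition zero_functional :: "'x::real_normed_vector set \<Rightarrow> 'x \<Rightarrow> real" where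
  "zero_functional Y = restrict (\<lambda>_. 0) Y"

definition subdifferential ::
  "'x::real_normed_vector set \<Rightarrow> ('x \<Rightarrow> ereal) \<Rightarrow> 'x \<Rightarrow> ('x \<Rightarrow> real) set" where
  "subdifferential Y f u =
     {\<alpha> \<in> dual_space Y. \<forall>v\<in>Y. ereal (\<alpha> v) \<le> gen_dir_deriv Y f u v}"

end

theory Submission
  imports Defs
begin

text \<open>
  The directional derivative at \<open>u\<close> is homogeneous, \<open>G\<close>-invariant and bounds every
  subgradient from above on \<open>V u\<close>; replacing \<open>v\<close> by \<open>-v\<close>, it agrees there with any subgradient, so
  it is additive if there is one. On each closed convex invariant piece of \<open>V u\<close> it is
  constant on the closed convex hull of every orbit. That hull is compact by Mazur's
  theorem and contains a fixed point \<open>p\<close>, so the derivative along \<open>v\<close> equals the one along \<open>p\<close>,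
  which vanishes by criticality on the fixed-point space applied to \<open>p\<close> and \<open>-p\<close>. The fixed point
  is found without Haar measure: a point of minimal orbit diameter is fixed, because averaging
  over a fine finite net of an orbit of positive diameter yields an orbit of smaller diameter.
\<close>

section \<open>Mazur's theorem on convex hulls of compact sets\<close>

text \<open>Completeness is closedness in a Banach space. For total boundedness, \<open>S\<close> is
  compared with a finite net \<open>F\<close>, whose convex hull is compact and so has a finite net
  \<open>N\<close>. Passing from the closure to the hull of \<open>S\<close>, then to the hull of
  \<open>F\<close>, then to \<open>N\<close> costs less than \<open>e/4\<close> each time.\<close>

lemma compact_closure_convex_hull:
  fixes S :: "'a::banach set"
  assumes "compact S"
  shows "compact (closure (convex hull S))"
  unfolding compact_eq_totally_bounded
proof (intro conjI allI impI)
  show "complete (closure (convex hull S))"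
    by (simp add: complete_eq_closed)
next
  fix e :: real
  assume "e > 0"
  then have e: "e / 4 > 0" by simp
  obtain F where F: "finite F" "S \<subseteq> (\<Union>x\<in>F. ball x (e/4))"
    using assms e unfolding compact_eq_totally_bounded by meson
  have "compact (convex hull F)"
    using F(1) by (rule finite_imp_compact_convex_hull)
  then obtain N where N: "finite N" "convex hull F \<subseteq> (\<Union>x\<in>N. ball x (e/4))"
    using e unfolding compact_eq_totally_bounded by meson
  \<comment> \<open>The \<open>e/4\<close>-neighbourhood of the hull of \<open>F\<close>. As a sum
    of two convex sets it is convex, so it contains the hull of \<open>S\<close> once it contains
    \<open>S\<close>.\<close>
  define H where "H = (\<Union>x\<in>convex hull F. \<Union>y\<in>ball 0 (e/4). {x + y})"
  have "convex H"
    unfolding H_def by (intro convex_sums convex_convex_hull convex_ball)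
  moreover have "S \<subseteq> H"
  proof
    fix s assume "s \<in> S"
    then obtain x where x: "x \<in> F" "dist x s < e/4"
      using F(2) by auto
    have "x \<in> convex hull F" using x(1) by (rule hull_inc)
    moreover have "s - x \<in> ball 0 (e/4)" using x(2) by (simp add: dist_norm norm_minus_commute)
    moreover have "s = x + (s - x)" by simp
    ultimately show "s \<in> H" unfolding H_def by blast
  qed
  ultimately have hull: "convex hull S \<subseteq> H" by (simp add: hull_minimal)
  have "closure (convex hull S) \<subseteq> (\<Union>x\<in>N. ball x e)"
  proof
    fix z assume "z \<in> closure (convex hull S)"
    then obtain h where h: "h \<in> convex hull S" "dist h z < e/4"
      using e by (meson closure_approachable)
    with hull have "h \<in> H" by blast
    then obtain x y where xy: "x \<in> convex hull F" "norm y < e/4" "h = x + y"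
      unfolding H_def by auto
    then obtain c where c: "c \<in> N" "dist c x < e/4"
      using N(2) by auto
    have "dist x h < e/4" using xy by (simp add: dist_norm)
    then have "dist c z < e"
      using c(2) h(2) dist_triangle[of c z x] dist_triangle[of x z h] \<open>e > 0\<close> by linarith
    then show "z \<in> (\<Union>x\<in>N. ball x e)" using c(1) by auto
  qed
  then show "\<exists>k. finite k \<and> closure (convex hull S) \<subseteq> (\<Union>x\<in>k. ball x e)"
    using N(1) by blast
qed

section \<open>Linear actions of compact groups\<close>

lemma linear_action_mult:
  assumes "linear_action G T act" "g \<in> carrier G" "h \<in> carrier G"
  shows "act (g \<otimes>\<^bsub>G\<^esub> h) x = act g (act h x)"
  using assms group_action.composition_rule[of G UNIV act x g h]
  by (simp add: linear_action_def)

lemma linear_action_group: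
  assumes "linear_action G T act"
  shows "group G"
  using assms unfolding linear_action_def group_action_def group_hom_def by blast

lemma linear_action_one:
  assumes "linear_action G T act"
  shows "act \<one>\<^bsub>G\<^esub> x = x"
  using assms group_action.id_eq_one[of G UNIV act]
  unfolding linear_action_def by (metis UNIV_I restrict_apply')

lemma linear_action_orbit_refl:
  assumes "linear_action G T act"
  shows "x \<in> orbit G act x"
  using assms group_action.orbit_refl[of G UNIV act x] by (simp add: linear_action_def)

lemma linear_action_inv:
  assumes "linear_action G T act" "g \<in> carrier G"
  shows "act g (act (inv\<^bsub>G\<^esub> g) x) = x"
proof -
  interpret group G using assms(1) by (rule linear_action_group)
  show ?thesis
    using linear_action_mult[OF assms(1) assms(2) inv_closed[OF assms(2)], of x]
      linear_action_one[OF assms(1)] assms(2) by simp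
qed

lemma linear_action_linear:
  assumes "linear_action G T act" "g \<in> carrier G"
  shows "linear (act g)"
  using assms by (simp add: linear_action_def)

text \<open>Joint continuity at the points \<open>(g, 0)\<close> and the tube lemma over the compact
  group give one ball around \<open>0\<close> that every \<open>act g\<close> sends into the unit
  ball; homogeneity turns this into an operator bound uniform in \<open>g\<close>.\<close>

lemma linear_action_uniform_bound:
  assumes act: "linear_action G T act" and T: "compact_space T" "topspace T = carrier G"
  obtains M where "M > 0" "\<And>g x. g \<in> carrier G \<Longrightarrow> norm (act g x) \<le> M * norm x"
proof -
  define W where "W = {z \<in> topspace (prod_topology T euclidean). (\<lambda>(g, u). act g u) z \<in> ball 0 1}"
  have "openin (prod_topology T euclidean) W"
    unfolding W_def
    by (rule openin_continuous_map_preimage[where Y=euclidean])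
       (use act in \<open>auto simp: linear_action_def\<close>)
  moreover have "compactin T (carrier G)"
    using T by (simp add: compact_space_def)
  moreover have "carrier G \<times> {0} \<subseteq> W"
    using linear_0[OF linear_action_linear[OF act]] T by (auto simp: W_def)
  ultimately obtain U X where UX: "openin T U" "open X" "carrier G \<subseteq> U" "0 \<in> X" "U \<times> X \<subseteq> W"
    using tube_lemma_left[of T euclidean W "carrier G" 0] by auto
  obtain e where e: "e > 0" "ball 0 e \<subseteq> X"
    using UX(2,4) open_contains_ball by blast
  show ?thesis
  proof
    show "2 / e > 0" using e by simp
    fix g x assume g: "g \<in> carrier G"
    have lin: "linear (act g)" using act g by (rule linear_action_linear)
    show "norm (act g x) \<le> 2 / e * norm x"
    proof (cases "x = 0")
      case True
      then show ?thesis using linear_0[OF lin] by simp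
    next
      case False
      \<comment> \<open>Scales \<open>x\<close> to norm \<open>e / 2\<close>, inside the ball of
        radius \<open>e\<close>; the bound \<open>1 / c\<close> then has the factor
        \<open>2 / e\<close>.\<close>
      define c where "c = e / (2 * norm x)"
      have c: "c > 0" using False e by (simp add: c_def)
      have "norm (c *\<^sub>R x) < e"
        using False e by (simp add: c_def)
      then have "c *\<^sub>R x \<in> X" using e(2) by (auto simp: subset_eq)
      then have "(g, c *\<^sub>R x) \<in> W" using UX(3,5) g by blast
      then have "norm (act g (c *\<^sub>R x)) < 1" by (simp add: W_def)
      then have "c * norm (act g x) < 1" using c by (simp add: linear_scale[OF lin])
      then have "norm (act g x) \<le> 1 / c" using c by (simp add: field_simps)
      also have "1 / c = 2 / e * norm x" by (simp add: c_def)
      finally show ?thesis .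
    qed
  qed
qed

lemma compact_linear_action_orbit:
  assumes act: "linear_action G T act" and T: "compact_space T" "topspace T = carrier G"
  shows "compact (orbit G act x)"
proof -
  have "continuous_map T (prod_topology T euclidean) (\<lambda>g. (g, x))"
    by (simp add: continuous_map_pairedI)
  then have "continuous_map T euclidean ((\<lambda>(g, u). act g u) \<circ> (\<lambda>g. (g, x)))"
    using act continuous_map_compose unfolding linear_action_def by blast
  then have "compactin euclidean (((\<lambda>(g, u). act g u) \<circ> (\<lambda>g. (g, x))) ` topspace T)"
    using T(1) image_compactin unfolding compact_space_def by blast
  moreover have "((\<lambda>(g, u). act g u) \<circ> (\<lambda>g. (g, x))) ` topspace T = orbit G act x"
    using T(2) by (auto simp: orbit_def)
  ultimately show ?thesis by simp
qed

section \<open>Orbit diameters and fixed points\<close>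

lemma norm_diff_mean_le:
  fixes F :: "'b \<Rightarrow> 'a::real_normed_vector"
  assumes "finite k" "k \<noteq> {}"
  shows "norm (y - (1 / real (card k)) *\<^sub>R (\<Sum>x\<in>k. F x))
           \<le> (\<Sum>x\<in>k. norm (y - F x)) / real (card k)"
proof -
  have "card k > 0" using assms by (simp add: card_gt_0_iff)
  then have "y - (1 / real (card k)) *\<^sub>R (\<Sum>x\<in>k. F x) = (1 / real (card k)) *\<^sub>R (\<Sum>x\<in>k. y - F x)"
    by (simp add: sum_subtractf scaleR_right_diff_distrib sum_constant_scaleR)
  then show ?thesis
    using norm_sum[of "\<lambda>x. y - F x" k] by (simp add: divide_right_mono)
qed

text \<open>The new point is the average \<open>w'\<close> of a finite net \<open>k\<close> of the
  orbit. Among the points \<open>act h x\<close> with \<open>x\<close> in \<open>k\<close>, at least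
  one is within \<open>d / 2\<close> of a given orbit point and the others are within
  \<open>d\<close>, so their average \<open>act h w'\<close> is strictly closer than
  \<open>d\<close>, by a margin independent of \<open>h\<close>.\<close>

lemma linear_action_shrink_orbit:
  assumes act: "linear_action G T act" and T: "compact_space T" "topspace T = carrier G"
    and K: "convex K" "invariant_set G act K" "w \<in> K"
    and pos: "diameter (orbit G act w) > 0"
  obtains w' where "w' \<in> K" "diameter (orbit G act w') < diameter (orbit G act w)"
proof -
  interpret group G using act by (rule linear_action_group)
  define S where "S = orbit G act w"
  define d where "d = diameter S"
  have "d > 0" using pos by (simp add: d_def S_def)
  obtain M where M: "M > 0" "\<And>g x. g \<in> carrier G \<Longrightarrow> norm (act g x) \<le> M * norm x"
    using linear_action_uniform_bound[OF act T] by metis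
  have "compact S" unfolding S_def by (rule compact_linear_action_orbit[OF act T])
  have diam: "norm (x - y) \<le> d" if "x \<in> S" "y \<in> S" for x y
    using diameter_bounded_bound[OF compact_imp_bounded[OF \<open>compact S\<close>] that]
    by (simp add: d_def dist_norm)
  have S_act: "act g x \<in> S" if "g \<in> carrier G" "x \<in> S" for g x
    using that linear_action_mult[OF act] by (auto simp: S_def orbit_def) (metis m_closed)
  have "w \<in> S"
    unfolding S_def by (rule linear_action_orbit_refl[OF act])
  have "S \<subseteq> K"
    using K by (auto simp: S_def orbit_def invariant_set_def)
  \<comment> \<open>The net radius anticipates the factor \<open>M\<close> by which
    \<open>act h\<close> may stretch distances: \<open>M * (d / (2 * M)) = d / 2\<close>.\<close>
  have r: "d / (2 * M) > 0" using \<open>d > 0\<close> M by simp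
  obtain k where k: "finite k" "k \<subseteq> S" "S \<subseteq> (\<Union>x\<in>k. ball x (d / (2 * M)))"
    using compactE_image[OF \<open>compact S\<close>, of S "\<lambda>x. ball x (d / (2 * M))"] r
    by (metis (no_types, lifting) UN_iff centre_in_ball open_ball subsetI)
  have "k \<noteq> {}" using k(3) \<open>w \<in> S\<close> by auto
  define n where "n = real (card k)"
  have n: "n > 0" using k(1) \<open>k \<noteq> {}\<close> by (simp add: n_def card_gt_0_iff)
  define w' where "w' = (1 / n) *\<^sub>R (\<Sum>x\<in>k. x)"
  \<comment> \<open>The mean of \<open>n\<close> numbers, one equal to \<open>d / 2\<close> and
    \<open>n - 1\<close> equal to \<open>d\<close>.\<close>
  define d' where "d' = d - d / (2 * n)"
  have act_w': "act g w' = (1 / n) *\<^sub>R (\<Sum>x\<in>k. act g x)" if "g \<in> carrier G" for g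
    unfolding w'_def
    using linear_action_linear[OF act that] by (simp add: linear_scale linear_sum)
  have near: "norm (y - act h w') \<le> d'" if y: "y \<in> S" and h: "h \<in> carrier G" for y h
  proof -
    \<comment> \<open>Pulling \<open>y\<close> back by \<open>h\<close> lets the single net
      \<open>k\<close> serve for all its translates.\<close>
    have "act (inv\<^bsub>G\<^esub> h) y \<in> S" using S_act y h by simp
    then obtain x0 where x0: "x0 \<in> k" "dist x0 (act (inv\<^bsub>G\<^esub> h) y) < d / (2 * M)"
      using k(3) by auto
    have "y - act h x0 = act h (act (inv\<^bsub>G\<^esub> h) y - x0)"
      using linear_diff[OF linear_action_linear[OF act h]] linear_action_inv[OF act h] by simp
    then have "norm (y - act h x0) \<le> M * norm (act (inv\<^bsub>G\<^esub> h) y - x0)"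
      using M(2)[OF h] by simp
    also have "\<dots> \<le> M * (d / (2 * M))"
      using x0(2) M(1) by (intro mult_left_mono) (auto simp: dist_norm norm_minus_commute)
    finally have near0: "norm (y - act h x0) \<le> d / 2" using M(1) by simp
    have "(\<Sum>x\<in>k. norm (y - act h x)) = norm (y - act h x0) + (\<Sum>x\<in>k - {x0}. norm (y - act h x))"
      using k(1) x0(1) by (rule sum.remove)
    also have "(\<Sum>x\<in>k - {x0}. norm (y - act h x)) \<le> (\<Sum>x\<in>k - {x0}. d)"
      using k(2) S_act[OF h] by (intro sum_mono diam y) auto
    also have "(\<Sum>x\<in>k - {x0}. d) = (n - 1) * d"
      using k(1) x0(1) \<open>k \<noteq> {}\<close>
      by (simp add: n_def of_nat_diff Suc_leI card_gt_0_iff)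
    finally have "(\<Sum>x\<in>k. norm (y - act h x)) \<le> d / 2 + (n - 1) * d"
      using near0 by simp
    then have "(\<Sum>x\<in>k. norm (y - act h x)) / n \<le> (d / 2 + (n - 1) * d) / n"
      using n by (simp add: divide_right_mono)
    also have "\<dots> = d'" using n by (simp add: d'_def field_simps)
    finally show ?thesis
      using norm_diff_mean_le[OF k(1) \<open>k \<noteq> {}\<close>, of y "act h"] act_w'[OF h]
      by (simp add: n_def)
  qed
  \<comment> \<open>A second averaging: \<open>act g w'\<close> is the mean of the orbit points
    \<open>act g x\<close>, and \<open>near\<close> applies to each of them.\<close>
  have "norm (act g w' - act h w') \<le> d'" if g: "g \<in> carrier G" and h: "h \<in> carrier G" for g h
  proof -
    have "(\<Sum>x\<in>k. norm (act h w' - act g x)) \<le> (\<Sum>x\<in>k. d')"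
      using near[OF S_act[OF g] h] k(2) by (intro sum_mono) (auto simp: norm_minus_commute)
    then have "(\<Sum>x\<in>k. norm (act h w' - act g x)) / n \<le> d'"
      using n by (simp add: field_simps n_def)
    then show ?thesis
      using norm_diff_mean_le[OF k(1) \<open>k \<noteq> {}\<close>, of "act h w'" "act g"] act_w'[OF g]
      by (simp add: n_def norm_minus_commute)
  qed
  then have "diameter (orbit G act w') \<le> d'"
    by (intro diameter_le) (auto simp: orbit_def)
  also have "d' < d" using \<open>d > 0\<close> n by (simp add: d'_def)
  finally have "diameter (orbit G act w') < diameter (orbit G act w)"
    by (simp add: d_def S_def)
  moreover have "w' \<in> K"
  proof -
    have "(\<Sum>x\<in>k. (1 / n) *\<^sub>R x) \<in> K"
      using k \<open>S \<subseteq> K\<close> n by (intro convex_sum[OF _ K(1)]) (auto simp: n_def)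
    then show ?thesis by (simp add: w'_def scaleR_right.sum)
  qed
  ultimately show ?thesis using that by blast
qed

text \<open>Replacing \<open>w\<close> by \<open>z\<close> moves each orbit point by at most
  \<open>M * dist w z\<close>, hence the distance of two of them by at most twice that: the diameter
  is Lipschitz with constant \<open>2 * M\<close>.\<close>

lemma compact_linear_action_diameter_orbit_continuous:
  assumes act: "linear_action G T act" and T: "compact_space T" "topspace T = carrier G"
  shows "continuous_on S (\<lambda>w. diameter (orbit G act w))"
proof -
  interpret group G using act by (rule linear_action_group)
  obtain M where M: "M > 0" "\<And>g x. g \<in> carrier G \<Longrightarrow> norm (act g x) \<le> M * norm x"
    using linear_action_uniform_bound[OF act T] by metis
  have le: "diameter (orbit G act w) \<le> diameter (orbit G act z) + 2 * M * dist w z" for w z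
  proof (rule diameter_le)
    show "orbit G act w \<noteq> {} \<or> 0 \<le> diameter (orbit G act z) + 2 * M * dist w z"
      using one_closed by (auto simp: orbit_def)
    fix x y assume "x \<in> orbit G act w" "y \<in> orbit G act w"
    then obtain g h where gh: "g \<in> carrier G" "h \<in> carrier G" "x = act g w" "y = act h w"
      by (auto simp: orbit_def)
    have shift: "norm (act a w - act a z) \<le> M * dist w z" if "a \<in> carrier G" for a
      using M(2)[OF that, of "w - z"] linear_diff[OF linear_action_linear[OF act that]]
      by (simp add: dist_norm)
    have "act g z \<in> orbit G act z" "act h z \<in> orbit G act z"
      using gh by (auto simp: orbit_def)
    then have "norm (act g z - act h z) \<le> diameter (orbit G act z)"
      using diameter_bounded_bound[OF compact_imp_bounded[OF compact_linear_action_orbit[OF act T]]]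
      by (metis dist_norm)
    moreover have "x - y = (act g w - act g z) + ((act g z - act h z) - (act h w - act h z))"
      using gh by simp
    moreover have "norm ((act g w - act g z) + ((act g z - act h z) - (act h w - act h z)))
        \<le> norm (act g w - act g z) + (norm (act g z - act h z) + norm (act h w - act h z))"
      by (intro norm_triangle_le add_mono norm_triangle_ineq4 order_refl)
    ultimately show "norm (x - y) \<le> diameter (orbit G act z) + 2 * M * dist w z"
      using shift[OF gh(1)] shift[OF gh(2)] by simp
  qed
  have "(2 * M)-lipschitz_on S (\<lambda>w. diameter (orbit G act w))"
  proof (rule lipschitz_onI)
    fix w z
    show "dist (diameter (orbit G act w)) (diameter (orbit G act z)) \<le> 2 * M * dist w z"
      using le[of w z] le[of z w] by (simp add: dist_real_def dist_commute abs_le_iff)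
  qed (use M in simp)
  then show ?thesis by (rule lipschitz_on_continuous_on)
qed

text \<open>The orbit diameter attains its minimum on \<open>K\<close>; by the shrinking lemma the
  minimum cannot be positive, and an orbit of diameter \<open>0\<close> is a single point.\<close>

lemma compact_linear_action_fixed_point:
  assumes act: "linear_action G T act" and T: "compact_space T" "topspace T = carrier G"
    and K: "compact K" "convex K" "K \<noteq> {}" "invariant_set G act K"
  shows "K \<inter> Fix G act \<noteq> {}"
proof -
  interpret group G using act by (rule linear_action_group)
  obtain w where w: "w \<in> K" "\<And>z. z \<in> K \<Longrightarrow> diameter (orbit G act w) \<le> diameter (orbit G act z)"
    using continuous_attains_inf[OF K(1,3)
        compact_linear_action_diameter_orbit_continuous[OF act T]] by blast
  have "diameter (orbit G act w) \<le> 0"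
    using linear_action_shrink_orbit[OF act T K(2,4) w(1)] w(2) by (metis not_le)
  have "act g w = w" if g: "g \<in> carrier G" for g
  proof -
    have "act g w \<in> orbit G act w" "w \<in> orbit G act w"
      using g linear_action_orbit_refl[OF act] by (auto simp: orbit_def)
    then have "dist (act g w) w \<le> diameter (orbit G act w)"
      by (intro diameter_bounded_bound compact_imp_bounded compact_linear_action_orbit[OF act T])
    with \<open>diameter (orbit G act w) \<le> 0\<close> have "dist (act g w) w \<le> 0" by linarith
    then show ?thesis by simp
  qed
  with w(1) show ?thesis by (auto simp: Fix_def)
qed

lemma compact_linear_action_fixed_point_in_orbit_hull:
  fixes act :: "'g \<Rightarrow> 'x::banach \<Rightarrow> 'x"
  assumes act: "linear_action G T act" and T: "compact_space T" "topspace T = carrier G"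
  obtains p where "p \<in> Fix G act" "p \<in> closure (convex hull (orbit G act v))"
proof -
  interpret group G using act by (rule linear_action_group)
  obtain M where M: "M > 0" "\<And>g x. g \<in> carrier G \<Longrightarrow> norm (act g x) \<le> M * norm x"
    using linear_action_uniform_bound[OF act T] by metis
  let ?O = "orbit G act v"
  have "act g ` closure (convex hull ?O) \<subseteq> closure (convex hull ?O)" if g: "g \<in> carrier G" for g
  proof -
    have lin: "linear (act g)" using act g by (rule linear_action_linear)
    \<comment> \<open>Boundedness carries the invariance of the hull over to its closure.\<close>
    have "bounded_linear (act g)"
      using lin M(2)[OF g] by (intro bounded_linear_intro[where K=M])
        (auto simp: linear_add linear_scale mult.commute)
    then have "act g ` closure (convex hull ?O) \<subseteq> closure (act g ` (convex hull ?O))"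
      by (rule closure_bounded_linear_image_subset)
    also have "act g ` (convex hull ?O) = convex hull (act g ` ?O)"
      using lin by (rule convex_hull_linear_image)
    also have "act g ` ?O \<subseteq> ?O"
      using g linear_action_mult[OF act] by (auto simp: orbit_def) (metis m_closed)
    finally show ?thesis by (simp add: closure_mono hull_mono)
  qed
  then have "closure (convex hull ?O) \<inter> Fix G act \<noteq> {}"
    using one_closed
    by (intro compact_linear_action_fixed_point[OF act T])
       (auto simp: invariant_set_def orbit_def convex_closure
         intro!: compact_closure_convex_hull compact_linear_action_orbit[OF act T, unfolded orbit_def])
  then show ?thesis using that by blast
qed

section \<open>Directional derivatives\<close>

lemma has_dir_deriv_unique:
  assumes "has_dir_deriv f u v d"
  shows "dir_deriv f u v = d"
  unfolding dir_deriv_def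
proof (rule the_equality)
  fix e assume "has_dir_deriv f u v e"
  with assms have "ereal e = ereal d"
    unfolding has_dir_deriv_def by (intro tendsto_unique[OF trivial_limit_at]) auto
  then show "e = d" by simp
qed (rule assms)

lemma has_dir_deriv_scaleR:
  assumes "has_dir_deriv f u v d" "\<bar>f u\<bar> \<noteq> \<infinity>"
  shows "has_dir_deriv f u (c *\<^sub>R v) (c * d)"
proof (cases "c = 0")
  case True
  \<comment> \<open>Finiteness of \<open>f u\<close> matters here: for an infinite value,
    \<open>f u - f u\<close> is not \<open>0\<close> in \<open>ereal\<close>.\<close>
  have "(\<lambda>t::real. (f (u + t *\<^sub>R c *\<^sub>R v) - f u) / ereal t) = (\<lambda>t. 0)"
    using True assms(2) by auto
  then show ?thesis by (simp only: has_dir_deriv_def True) (simp add: zero_ereal_def)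
next
  case False
  let ?q = "\<lambda>t::real. (f (u + t *\<^sub>R v) - f u) / ereal t"
  \<comment> \<open>The limit is two-sided, so the substitution also covers negative
    \<open>c\<close>, and with it the direction \<open>- v\<close>.\<close>
  have "filterlim (\<lambda>t. c * t) (at 0) (at (0::real))"
    using False by (intro filterlim_atI tendsto_eq_intros) (auto simp: eventually_at_filter)
  then have "((\<lambda>t. ?q (c * t)) \<longlongrightarrow> ereal d) (at 0)"
    using assms(1) filterlim_compose unfolding has_dir_deriv_def by blast
  then have "((\<lambda>t. ereal c * ?q (c * t)) \<longlongrightarrow> ereal c * ereal d) (at 0)"
    using False by (intro tendsto_cmult_ereal) auto
  moreover have "ereal c * ?q (c * t) = (f (u + t *\<^sub>R c *\<^sub>R v) - f u) / ereal t" if "t \<noteq> 0" for t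
  proof -
    have "ereal c * (x / ereal (c * t)) = x / ereal t" for x
      using False that by (cases x) (auto simp: divide_ereal_def field_simps sgn_mult zero_less_mult_iff mult_less_0_iff)
    then show ?thesis by (simp add: mult.commute)
  qed
  then have "\<forall>\<^sub>F t in at 0. ereal c * ?q (c * t) = (f (u + t *\<^sub>R c *\<^sub>R v) - f u) / ereal t"
    by (auto simp: eventually_at_filter)
  ultimately show ?thesis
    unfolding has_dir_deriv_def using tendsto_cong by fastforce
qed

text \<open>\<open>act g\<close> fixes \<open>u\<close> and maps the line through \<open>u\<close>
  along \<open>v\<close> to the line along \<open>act g v\<close>, so by invariance of
  \<open>f\<close> the difference quotients coincide.\<close>

lemma has_dir_deriv_act:
  assumes act: "linear_action G T act" "g \<in> carrier G"
    and f: "\<And>w. f (act g w) = f w" and u: "act g u = u" and d: "has_dir_deriv f u v d"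
  shows "has_dir_deriv f u (act g v) d"
proof -
  have "u + t *\<^sub>R act g v = act g (u + t *\<^sub>R v)" for t
    using linear_action_linear[OF act] u by (simp add: linear_add linear_scale)
  then show ?thesis using d f by (simp add: has_dir_deriv_def)
qed

text \<open>The level set of \<open>D\<close> in \<open>C\<close> is convex by \<open>affine\<close>
  and closed because \<open>D\<close> is continuous on the closed set \<open>C\<close>; containing
  \<open>S\<close>, it contains the closed convex hull.\<close>

lemma constant_on_closure_convex_hull:
  fixes D :: "'x::real_normed_vector \<Rightarrow> real"
  assumes C: "convex C" "closed C" "S \<subseteq> C" "continuous_on C D"
    and affine: "\<And>x y a b. x \<in> C \<Longrightarrow> y \<in> C \<Longrightarrow> D (a *\<^sub>R x + b *\<^sub>R y) = a * D x + b * D y"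
    and const: "\<And>x. x \<in> S \<Longrightarrow> D x = c"
    and p: "p \<in> closure (convex hull S)"
  shows "D p = c"
proof -
  let ?L = "{x \<in> C. D x = c}"
  have "convex ?L"
  proof (rule convexI)
    fix x y and a b :: real
    assume *: "x \<in> ?L" "y \<in> ?L" "0 \<le> a" "0 \<le> b" "a + b = 1"
    then have "a *\<^sub>R x + b *\<^sub>R y \<in> C" using C(1) by (simp add: convexD)
    moreover have "D (a *\<^sub>R x + b *\<^sub>R y) = a * c + b * c" using * affine[of x y] by auto
    moreover have "a * c + b * c = c" using * by (metis distrib_right mult_1)
    ultimately show "a *\<^sub>R x + b *\<^sub>R y \<in> ?L" by simp
  qed
  moreover have "S \<subseteq> ?L" using C(3) const by auto
  ultimately have "convex hull S \<subseteq> ?L" by (rule hull_minimal[rotated])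
  moreover have "closed ?L"
    using continuous_closed_preimage_constant[OF C(4,2)] by simp
  ultimately have "closure (convex hull S) \<subseteq> ?L" by (rule closure_minimal)
  with p show ?thesis by blast
qed

section \<open>Symmetric criticality\<close>

theorem theorem4p1:
  fixes G :: "('g, 'm) monoid_scheme"
    and T :: "'g topology"
    and n :: nat
    and A :: "('g set \<times> ('g \<Rightarrow> nat \<Rightarrow> real)) set"
    and act :: "'g \<Rightarrow> 'x::banach \<Rightarrow> 'x"
    and f :: "'x \<Rightarrow> ereal"
    and V :: "'x \<Rightarrow> 'x set"
    and u :: 'x
  assumes "compact_lie_group G T n A"
    and "linear_action G T act"
    and "\<forall>g\<in>carrier G. \<forall>w. f (act g w) = f w"
    and "\<forall>w\<in>Fix G act. subspace (V w) \<and> closure (V w) = UNIV \<and> invariant_set G act (V w)"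
    and "\<forall>w\<in>Fix G act. \<bar>f w\<bar> \<noteq> \<infinity> \<longrightarrow> (\<forall>v\<in>V w. \<exists>d. has_dir_deriv f w v d)"
    and "\<forall>w\<in>Fix G act. \<bar>f w\<bar> \<noteq> \<infinity> \<longrightarrow>
           (\<forall>v\<in>V w \<inter> Fix G act. gen_dir_deriv (Fix G act) f w v \<le> ereal (dir_deriv f w v))"
    and "\<forall>w\<in>Fix G act. \<bar>f w\<bar> \<noteq> \<infinity> \<longrightarrow>
           (\<forall>v\<in>V w. gen_dir_deriv UNIV f w v \<le> ereal (dir_deriv f w v))"
    and "\<forall>w\<in>Fix G act. \<exists>\<C>. V w = \<Union>\<C> \<and>
           (\<forall>C\<in>\<C>. convex C \<and> closed C \<and> invariant_set G act C \<and>
              (\<bar>f w\<bar> \<noteq> \<infinity> \<longrightarrow> continuous_on C (dir_deriv f w)))"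
    and "u \<in> Fix G act" and "\<bar>f u\<bar> \<noteq> \<infinity>"
    and "zero_functional (Fix G act) \<in> subdifferential (Fix G act) f u"
    and "subdifferential UNIV f u = {} \<longrightarrow>
           (\<forall>v\<in>V u. \<forall>w\<in>V u. dir_deriv f u (v + w) = dir_deriv f u v + dir_deriv f u w)"
  shows "(\<forall>v\<in>V u. dir_deriv f u v = 0) \<and>
         (subdifferential UNIV f u \<noteq> {} \<longrightarrow>
            subdifferential UNIV f u = {zero_functional UNIV})"
proof -
  let ?F = "Fix G act"
  let ?D = "dir_deriv f u"
  have T: "compact_space T" "topspace T = carrier G"
    using assms(1) by (auto simp: compact_lie_group_def lie_group_def)
  note act = assms(2) and u = assms(9) and fin = assms(10)
  have V: "subspace (V u)" "closure (V u) = UNIV"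
    using assms(4) u by auto
  have D: "has_dir_deriv f u v (?D v)" if "v \<in> V u" for v
    using assms(5) u fin that has_dir_deriv_unique by metis
  have scale: "?D (c *\<^sub>R v) = c * ?D v" if "v \<in> V u" for c v
    using has_dir_deriv_scaleR[OF D[OF that] fin] by (rule has_dir_deriv_unique)
  have neg: "?D (- v) = - ?D v" if "v \<in> V u" for v
    using scale[OF that, of "-1"] by simp
  have upper: "gen_dir_deriv UNIV f u v \<le> ereal (?D v)" if "v \<in> V u" for v
    using assms(7)[rule_format, OF u fin that] .
  \<comment> \<open>The generalized derivative lies between \<open>\<alpha>\<close> and
    \<open>?D\<close>. Both are odd on \<open>V u\<close>, so the inequality at \<open>- v\<close>
    is the reverse of the one at \<open>v\<close>.\<close>
  have sub_eq: "\<alpha> v = ?D v" if \<alpha>: "\<alpha> \<in> subdifferential UNIV f u" and v: "v \<in> V u" for \<alpha> v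
  proof -
    have le: "\<alpha> w \<le> ?D w" if "w \<in> V u" for w
      using \<alpha> upper[OF that] unfolding subdifferential_def
      by (metis (no_types, lifting) UNIV_I ereal_less_eq(3) mem_Collect_eq order_trans)
    have "\<forall>c w. \<alpha> (c *\<^sub>R w) = c * \<alpha> w"
      using \<alpha> by (simp add: subdifferential_def dual_space_def)
    then have "\<alpha> (- v) = - \<alpha> v"
      by (metis mult_minus1 scaleR_minus1_left)
    then show ?thesis
      using le[OF v] le[OF subspace_neg[OF V(1) v]] neg[OF v] by simp
  qed
  \<comment> \<open>Additivity is inherited from any subgradient; without one it is a
    hypothesis.\<close>
  have add: "?D (v + w) = ?D v + ?D w" if "v \<in> V u" "w \<in> V u" for v w
  proof (cases "subdifferential UNIV f u = {}")
    case True
    then show ?thesis using assms(12) that by blast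
  next
    case False
    then obtain \<alpha> where \<alpha>: "\<alpha> \<in> subdifferential UNIV f u" by blast
    then have "\<alpha> (v + w) = \<alpha> v + \<alpha> w"
      by (simp add: subdifferential_def dual_space_def)
    then show ?thesis
      using sub_eq[OF \<alpha>] that subspace_add[OF V(1)] by simp
  qed
  have crit: "?D p = 0" if p: "p \<in> V u" "p \<in> ?F" for p
  proof -
    have nonneg: "0 \<le> ?D q" if q: "q \<in> V u" "q \<in> ?F" for q
    proof -
      have "ereal (zero_functional ?F q) \<le> gen_dir_deriv ?F f u q"
        using assms(11) q(2) by (simp add: subdifferential_def)
      also have "\<dots> \<le> ereal (?D q)"
        using assms(6)[rule_format, OF u fin] q by blast
      \<comment> \<open>\<open>zero_functional\<close> has the value \<open>0\<close> only on the
        fixed-point space, being \<open>undefined\<close> elsewhere.\<close>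
      finally show ?thesis using q(2) by (simp add: zero_functional_def)
    qed
    have "- p \<in> ?F"
      using p(2) linear_neg[OF linear_action_linear[OF act]] by (simp add: Fix_def)
    then show ?thesis
      using nonneg[OF p] nonneg[OF subspace_neg[OF V(1) p(1)]] neg[OF p(1)] by simp
  qed
  have zero: "?D v = 0" if v: "v \<in> V u" for v
  proof -
    obtain \<C> where \<C>: "V u = \<Union>\<C>"
        "\<forall>C\<in>\<C>. convex C \<and> closed C \<and> invariant_set G act C \<and> continuous_on C ?D"
      using bspec[OF assms(8) u] fin by (elim exE conjE) simp
    from v have "v \<in> \<Union>\<C>" unfolding \<C>(1) .
    then obtain C where "v \<in> C" "C \<in> \<C>" by blast
    then have C: "convex C" "closed C" "invariant_set G act C" "continuous_on C ?D" "C \<subseteq> V u"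
      using \<C>(2) Union_upper[OF \<open>C \<in> \<C>\<close>] unfolding \<C>(1) by blast+
    have OC: "orbit G act v \<subseteq> C"
      using C(3) \<open>v \<in> C\<close> by (auto simp: orbit_def invariant_set_def)
    obtain p where p: "p \<in> ?F" "p \<in> closure (convex hull (orbit G act v))"
      using compact_linear_action_fixed_point_in_orbit_hull[OF act T] by blast
    \<comment> \<open>Staying inside one piece \<open>C\<close> puts \<open>p\<close> into
      \<open>V u\<close>, where \<open>crit\<close> applies, and keeps the hull where
      \<open>?D\<close> is known to be continuous.\<close>
    have "closure (convex hull (orbit G act v)) \<subseteq> C"
      using OC C(1,2) by (intro closure_minimal hull_minimal)
    with p(2) C(5) have "p \<in> V u" by blast
    have inv: "?D (act g v) = ?D v" if g: "g \<in> carrier G" for g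
      using has_dir_deriv_act[OF act g _ _ D[OF v]] assms(3) u g
      by (intro has_dir_deriv_unique) (simp add: Fix_def)
    have "?D p = ?D v"
    proof (rule constant_on_closure_convex_hull[OF C(1,2) OC C(4) _ _ p(2)])
      fix x assume "x \<in> orbit G act v"
      then show "?D x = ?D v" using inv by (auto simp: orbit_def)
    next
      fix x y and a b :: real assume "x \<in> C" "y \<in> C"
      then have "x \<in> V u" "y \<in> V u" using C(5) by auto
      then show "?D (a *\<^sub>R x + b *\<^sub>R y) = a * ?D x + b * ?D y"
        by (simp add: add scale subspace_scale[OF V(1)])
    qed
    then show ?thesis using crit[OF \<open>p \<in> V u\<close> p(1)] by simp
  qed
  \<comment> \<open>A subgradient agrees with \<open>?D\<close>, hence vanishes, on the dense
    subspace \<open>V u\<close>; continuity extends this to the whole space.\<close>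
  have "\<alpha> = zero_functional UNIV" if \<alpha>: "\<alpha> \<in> subdifferential UNIV f u" for \<alpha>
  proof
    fix x
    have "continuous_on (closure (V u)) \<alpha>"
      using \<alpha> V(2) by (simp add: subdifferential_def dual_space_def)
    then have "\<alpha> x = 0"
      by (rule continuous_constant_on_closure) (simp_all add: sub_eq[OF \<alpha>] zero V(2))
    then show "\<alpha> x = zero_functional UNIV x" by (simp add: zero_functional_def)
  qed
  then show ?thesis using zero by blast
qed

end
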